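(* Let $G$ be an $N$-player partizan game, and suppose there is a Left option $G^{\widehat L}$ of $G$ and a sequence of moves $G^{\widehat L}\to K_1\to K_2\to\cdots\to K_{N-1}$ in which $K_1$ is a $C_1$-option of $G^{\widehat L}$, each $K_{j+1}$ is a $C_{j+1}$-option of $K_j$, and $K:=K_{N-1}$ (reached by a Right move) satisfies $K\le_L G$. Let $G'$ be the game whose Left options are all Left options of $K$ together with all Left options of $G$ other than $G^{\widehat L}$, and whose $C_i$-options for $1\le i\le N-1$ are exactly those of $G$. Then $G'=_L G$.
   Context: An $N$-player partizan game ($N\ge2$) is an ordered $N$-tuple $(\mathscr G^{C_0},\dots,\mathscr G^{C_{N-1}})$ of finite sets of partizan games (no infinite runs); players Left $=C_0$, $C_1,\dots,C_{N-2}$, Right $=C_{N-1}$ move cyclically (Left after Right), $\mathscr G^{C_i}$ being the options for $C_i$. Under normal play, a player with no option on their turn is the unique loser and all others win. The disjunctive sum $G+H$ has $C_i$-options $G^{C_i}+H$ and $G+H^{C_i}$. "Left has a winning strategy in $G$ moving $i$th" means that when play starts with the player for whom Left is $i$th to move, Left can guarantee not being the loser. $G\le_L H$ means: for every game $X$ and every $1\le i\le N$, if Left has a winning strategy in $G+X$ moving $i$th then Left has one in $H+X$ moving $i$th. $G=_L H$ means $G\le_L H$ and $H\le_L G$. *)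

theory Defs
  imports Main "HOL-Library.FSet"
begin

text \<open>
  A partizan game is represented by the family of its finite option sets: \<open>options G i\<close> is the set
  of options for the player \<open>C\<^sub>i\<close>. Left is player \<open>0\<close> and Right is player \<open>N - 1\<close>.
  Since this is an inductive datatype, there are no infinite runs.
\<close>

datatype game = Game (options: "nat \<Rightarrow> game fset")

text \<open>
  An ordered \<open>N\<close>-tuple of option sets is encoded as a family that is empty from index \<open>N\<close> on;
  this is required hereditarily.
\<close>

inductive is_game :: "nat \<Rightarrow> game \<Rightarrow> bool" for N where
  "(\<And>i. N \<le> i \<Longrightarrow> options G i = {||}) \<Longrightarrow>
   (\<And>i H. i < N \<Longrightarrow> H |\<in>| options G i \<Longrightarrow> is_game N H) \<Longrightarrow> is_game N G"

definition option_rel :: "(game \<times> game) set" where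
  "option_rel = {(H, G). \<exists>i. H |\<in>| options G i}"

lemma wf_option_rel: "wf option_rel"
proof (rule wfUNIVI)
  fix P G
  assume *: "\<forall>G. (\<forall>H. (H, G) \<in> option_rel \<longrightarrow> P H) \<longrightarrow> P G"
  show "P G"
  proof (induction G)
    case (Game f)
    have "P H" if "(H, Game f) \<in> option_rel" for H
      using that Game by (auto simp: option_rel_def)
    with * show ?case by blast
  qed
qed

function disj_sum :: "game \<Rightarrow> game \<Rightarrow> game" where
  "disj_sum G H =
     Game (\<lambda>i. (\<lambda>G'. disj_sum G' H) |`| options G i |\<union>| (\<lambda>H'. disj_sum G H') |`| options H i)"
  by auto
termination
proof (relation "option_rel <*lex*> option_rel")
  show "wf (option_rel <*lex*> option_rel)"
    by (intro wf_lex_prod wf_option_rel)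
qed (unfold in_lex_prod option_rel_def, blast+)

declare disj_sum.simps [simp del]

lemma options_disj_sum:
  "options (disj_sum G H) i =
     (\<lambda>G'. disj_sum G' H) |`| options G i |\<union>| (\<lambda>H'. disj_sum G H') |`| options H i"
  by (subst disj_sum.simps) simp

text \<open>
  A strategy for Left selects a move in every position in which it is Left's turn.
  \<open>reachable N \<sigma> p G q H\<close>: when player \<open>C\<^sub>p\<close> starts in \<open>G\<close> and Left follows \<open>\<sigma>\<close> (the other players
  moving arbitrarily), the play may get to \<open>H\<close> with player \<open>C\<^sub>q\<close> to move.
\<close>

inductive reachable ::
    "nat \<Rightarrow> (game \<Rightarrow> game) \<Rightarrow> nat \<Rightarrow> game \<Rightarrow> nat \<Rightarrow> game \<Rightarrow> bool"
  for N \<sigma> p G where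
  start: "reachable N \<sigma> p G p G"
| left: "reachable N \<sigma> p G 0 H \<Longrightarrow> \<sigma> H |\<in>| options H 0 \<Longrightarrow>
    reachable N \<sigma> p G (Suc 0 mod N) (\<sigma> H)"
| other: "reachable N \<sigma> p G q H \<Longrightarrow> q \<noteq> 0 \<Longrightarrow> H' |\<in>| options H q \<Longrightarrow>
    reachable N \<sigma> p G (Suc q mod N) H'"

text \<open>
  Every play ends with a player who cannot move and who is the only loser. So Left does not lose
  as long as \<open>\<sigma>\<close> provides a legal move whenever it is Left's turn.
\<close>

definition winning_strategy :: "nat \<Rightarrow> (game \<Rightarrow> game) \<Rightarrow> nat \<Rightarrow> game \<Rightarrow> bool" where
  "winning_strategy N \<sigma> p G \<longleftrightarrow>
     (\<forall>H. reachable N \<sigma> p G 0 H \<longrightarrow> \<sigma> H |\<in>| options H 0)"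

definition left_wins_from :: "nat \<Rightarrow> nat \<Rightarrow> game \<Rightarrow> bool" where
  "left_wins_from N p G \<longleftrightarrow> (\<exists>\<sigma>. winning_strategy N \<sigma> p G)"

text \<open>
  Left is the \<open>i\<close>th player to move if the play starts with \<open>C\<^sub>0\<close> (for \<open>i = 1\<close>) or with
  \<open>C\<^bsub>N+1-i\<^esub>\<close> (for \<open>2 \<le> i \<le> N\<close>).
\<close>

definition left_wins_moving :: "nat \<Rightarrow> nat \<Rightarrow> game \<Rightarrow> bool" where
  "left_wins_moving N i G \<longleftrightarrow> left_wins_from N ((N + 1 - i) mod N) G"

definition le_left :: "nat \<Rightarrow> game \<Rightarrow> game \<Rightarrow> bool" where
  "le_left N G H \<longleftrightarrow>
     (\<forall>X. is_game N X \<longrightarrow> (\<forall>i\<in>{1..N}.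
        left_wins_moving N i (disj_sum G X) \<longrightarrow> left_wins_moving N i (disj_sum H X)))"

definition eq_left :: "nat \<Rightarrow> game \<Rightarrow> game \<Rightarrow> bool" where
  "eq_left N G H \<longleftrightarrow> le_left N G H \<and> le_left N H G"

text \<open>
  Backward induction. In particular, nothing is lost by considering only strategies that do not
  depend on the history of the play.
\<close>

lemma reachable_trans:
  assumes "reachable N \<sigma> q H r J" and "reachable N \<sigma> p G q H"
  shows "reachable N \<sigma> p G r J"
  using assms
proof induction
  case start
  then show ?case .
next
  case (left H)
  then show ?case by (blast intro: reachable.left)
next
  case (other q H H')
  then show ?case by (blast intro: reachable.other)
qed

lemma left_wins_from_step:
  assumes "left_wins_from N p G"
  shows "if p = 0 then \<exists>H. H |\<in>| options G 0 \<and> left_wins_from N (Suc 0 mod N) H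
    else \<forall>H. H |\<in>| options G p \<longrightarrow> left_wins_from N (Suc p mod N) H"
proof -
  obtain \<sigma> where \<sigma>: "winning_strategy N \<sigma> p G"
    using assms unfolding left_wins_from_def by blast
  have sub: "left_wins_from N q H" if "reachable N \<sigma> p G q H" for q H
    using \<sigma> reachable_trans[OF _ that] unfolding left_wins_from_def winning_strategy_def by blast
  show ?thesis
  proof (cases "p = 0")
    case True
    have r: "reachable N \<sigma> p G 0 G"
      using reachable.start[of N \<sigma> p G] True by simp
    then have *: "\<sigma> G |\<in>| options G 0"
      using \<sigma> unfolding winning_strategy_def by blast
    with True show ?thesis
      using sub[OF reachable.left[OF r *]] by auto
  next
    case False
    then show ?thesis
      using sub[OF reachable.other[OF reachable.start]] by simp
  qed
qed

lemma left_wins_from_coinduct: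
  assumes W: "W p G"
    and left: "\<And>G. W 0 G \<Longrightarrow> \<exists>H. H |\<in>| options G 0 \<and> W (Suc 0 mod N) H"
    and other: "\<And>q G H. W q G \<Longrightarrow> q \<noteq> 0 \<Longrightarrow> H |\<in>| options G q \<Longrightarrow> W (Suc q mod N) H"
  shows "left_wins_from N p G"
proof -
  define \<sigma> where "\<sigma> H = (SOME H'. H' |\<in>| options H 0 \<and> W (Suc 0 mod N) H')" for H
  have \<sigma>: "\<sigma> H |\<in>| options H 0 \<and> W (Suc 0 mod N) (\<sigma> H)" if "W 0 H" for H
    unfolding \<sigma>_def using left[OF that] by (rule someI_ex)
  have "W q H" if "reachable N \<sigma> p G q H" for q H
    using that
  proof induction
    case start
    show ?case by (fact W)
  next
    case (left H)
    then show ?case using \<sigma> by blast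
  next
    case (other q H H')
    then show ?case using assms(3) by blast
  qed
  then have "winning_strategy N \<sigma> p G"
    using \<sigma> unfolding winning_strategy_def by blast
  then show ?thesis unfolding left_wins_from_def by blast
qed

lemma left_wins_from_iff:
  "left_wins_from N p G \<longleftrightarrow>
     (if p = 0 then \<exists>H. H |\<in>| options G 0 \<and> left_wins_from N (Suc 0 mod N) H
      else \<forall>H. H |\<in>| options G p \<longrightarrow> left_wins_from N (Suc p mod N) H)"
    (is "_ \<longleftrightarrow> ?R p G")
proof
  assume R: "?R p G"
  define W where "W q H \<longleftrightarrow> ?R q H" for q H
  have le: "W q H" if "left_wins_from N q H" for q H
    unfolding W_def by (rule left_wins_from_step[OF that])
  show "left_wins_from N p G"
  proof (rule left_wins_from_coinduct[where W = W])
    show "W p G" unfolding W_def by (fact R)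
  next
    fix H assume "W 0 H"
    then obtain H' where "H' |\<in>| options H 0" "left_wins_from N (Suc 0 mod N) H'"
      unfolding W_def by auto
    with le show "\<exists>H'. H' |\<in>| options H 0 \<and> W (Suc 0 mod N) H'" by blast
  next
    fix q H H' assume "W q H" "q \<noteq> 0" "H' |\<in>| options H q"
    then have "left_wins_from N (Suc q mod N) H'" unfolding W_def by simp
    then show "W (Suc q mod N) H'" by (rule le)
  qed
qed (rule left_wins_from_step)

end

theory Submission imports Defs begin

text \<open>
  Both inequalities are proved by induction on the summand \<open>X\<close>. A winning Left move to
  \<open>K\<^sup>L + X\<close> witnesses a win on \<open>K + X\<close>, hence on \<open>G + X\<close>. Conversely, if the move to
  \<open>GL + X\<close> wins, then Left still wins on \<open>K + X\<close> after the others reply along the given sequence: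
  the next Left move is either in \<open>K\<close>, and so available in \<open>G'\<close>, or leads to some \<open>K + X'\<close>, where
  \<open>K \<le>\<^sub>L G\<close> and the induction hypothesis apply.
\<close>

text \<open>As \<open>i\<close> runs through \<open>{1..N}\<close>, the starting player
  \<open>(N + 1 - i) mod N\<close> runs through all players. Hence Left's place in the order of play
  can be traded for the player who starts, the form that fits recursion on moves.\<close>

lemma le_left_iff:
  assumes "N > 0"
  shows "le_left N G H \<longleftrightarrow> (\<forall>X. is_game N X \<longrightarrow> (\<forall>p<N.
    left_wins_from N p (disj_sum G X) \<longrightarrow> left_wins_from N p (disj_sum H X)))"
proof -
  have "(\<lambda>i. (N + 1 - i) mod N) ` {1..N} = {..<N}"
  proof (intro equalityI subsetI)
    fix p assume p: "p \<in> {..<N}"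
    show "p \<in> (\<lambda>i. (N + 1 - i) mod N) ` {1..N}"
    \<comment> \<open>A nonzero \<open>p\<close> comes from \<open>N + 1 - p\<close>. For
      \<open>p = 0\<close> this would be \<open>N + 1\<close>, which is out of range;
      \<open>1\<close> serves instead, since \<open>N mod N = 0\<close>.\<close>
    proof (cases "p = 0")
      case True
      with assms show ?thesis by (intro image_eqI[of _ _ 1]) auto
    next
      case False
      with p show ?thesis by (intro image_eqI[of _ _ "N + 1 - p"]) auto
    qed
  qed (use assms in auto)
  then have "(\<forall>i\<in>{1..N}. P ((N + 1 - i) mod N)) \<longleftrightarrow> (\<forall>p\<in>{..<N}. P p)" for P
    by (blast elim: equalityE)
  note this[of "\<lambda>p. left_wins_from N p (disj_sum G X) \<longrightarrow> left_wins_from N p (disj_sum H X)" for X]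
  then show ?thesis
    unfolding le_left_def left_wins_moving_def by (simp only: Ball_def lessThan_iff)
qed

lemma options_disj_sum_iff:
  "J |\<in>| options (disj_sum G H) i \<longleftrightarrow>
     (\<exists>G'. G' |\<in>| options G i \<and> J = disj_sum G' H) \<or>
     (\<exists>H'. H' |\<in>| options H i \<and> J = disj_sum G H')"
  by (auto simp: options_disj_sum)

lemma left_wins_from_disj_sum_0:
  "left_wins_from N 0 (disj_sum G X) \<longleftrightarrow>
     (\<exists>G'. G' |\<in>| options G 0 \<and> left_wins_from N (Suc 0 mod N) (disj_sum G' X)) \<or>
     (\<exists>X'. X' |\<in>| options X 0 \<and> left_wins_from N (Suc 0 mod N) (disj_sum G X'))"
  by (subst left_wins_from_iff) (auto simp: options_disj_sum_iff)

lemma left_wins_from_disj_sum_other: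
  assumes "p \<noteq> 0"
  shows "left_wins_from N p (disj_sum G X) \<longleftrightarrow>
     (\<forall>G'. G' |\<in>| options G p \<longrightarrow> left_wins_from N (Suc p mod N) (disj_sum G' X)) \<and>
     (\<forall>X'. X' |\<in>| options X p \<longrightarrow> left_wins_from N (Suc p mod N) (disj_sum G X'))"
  using assms by (subst left_wins_from_iff) (auto simp: options_disj_sum_iff)

text \<open>A win for Left survives every opposing move, in particular the prescribed replies in the
  first summand. For \<open>j < N - 1\<close> the player to move is \<open>Suc j < N\<close>, which
  is never Left.\<close>

lemma left_wins_from_after_replies:
  assumes "\<forall>j < N - 1. K (Suc j) |\<in>| options (K j) (Suc j)"
    and "left_wins_from N (Suc 0 mod N) (disj_sum (K 0) X)"
    and "j \<le> N - 1"
  shows "left_wins_from N (Suc j mod N) (disj_sum (K j) X)"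
  using assms(3)
proof (induction j)
  case 0
  show ?case by (fact assms(2))
next
  case (Suc j)
  then show ?case
    using assms(1) left_wins_from_disj_sum_other[of "Suc j" N "K j" X] by auto
qed

text \<open>An opponent's move in \<open>H\<close> is also a move in \<open>G\<close> and leads to
  the same sum; a move in \<open>X\<close> falls under the induction hypothesis. So induction on
  \<open>X\<close> leaves only positions with Left to move, where the hypothesis is passed on for
  Left's moves in \<open>X\<close>.\<close>

lemma le_leftI:
  assumes "N > 0"
    and other: "\<And>p. p \<noteq> 0 \<Longrightarrow> options H p = options G p"
    and left: "\<And>X. is_game N X \<Longrightarrow>
      (\<And>X' p. X' |\<in>| options X 0 \<Longrightarrow> p < N \<Longrightarrow>
        left_wins_from N p (disj_sum G X') \<Longrightarrow> left_wins_from N p (disj_sum H X')) \<Longrightarrow>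
      left_wins_from N 0 (disj_sum G X) \<Longrightarrow> left_wins_from N 0 (disj_sum H X)"
  shows "le_left N G H"
proof -
  have "left_wins_from N p (disj_sum H X)"
    if "is_game N X" "p < N" "left_wins_from N p (disj_sum G X)" for X p
    using that
  proof (induction arbitrary: p)
    case (1 X)
    have X: "is_game N X"
      by (rule is_game.intros) (use 1 in auto)
    show ?case
    proof (cases "p = 0")
      case True
      with 1 \<open>N > 0\<close> show ?thesis by (blast intro: left[OF X])
    next
      case False
      with 1 \<open>N > 0\<close> show ?thesis
        by (simp add: left_wins_from_disj_sum_other other)
    qed
  qed
  then show ?thesis
    by (simp add: le_left_iff[OF \<open>N > 0\<close>])
qed

theorem mainTheorem16:
  fixes N :: nat and G GL :: game and K :: "nat \<Rightarrow> game"
  assumes "N \<ge> 2"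
    and "is_game N G"
    and "GL |\<in>| options G 0"
    and "K 0 = GL"
    and "\<forall>j < N - 1. K (Suc j) |\<in>| options (K j) (Suc j)"
    and "le_left N (K (N - 1)) G"
  shows "eq_left N
      (Game ((options G)(0 := options (K (N - 1)) 0 |\<union>| (options G 0 |-| {|GL|})))) G"
proof -
  let ?K = "K (N - 1)"
  define G' where "G' = Game ((options G)(0 := options ?K 0 |\<union>| (options G 0 |-| {|GL|})))"
  have N: "N > 0" "Suc 0 mod N < N" using assms(1) by auto
  have other: "options G' p = options G p" if "p \<noteq> 0" for p
    using that by (simp add: G'_def)
  have G'0: "options G' 0 = options ?K 0 |\<union>| (options G 0 |-| {|GL|})"
    by (simp add: G'_def)
  have KG: "left_wins_from N p (disj_sum G X)"
    if "is_game N X" "p < N" "left_wins_from N p (disj_sum ?K X)" for X p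
    using assms(6) that by (simp add: le_left_iff[OF N(1)])
  have "le_left N G' G"
  proof (rule le_leftI[OF N(1)])
    fix X
    assume X: "is_game N X"
      and IH: "\<And>X' p. X' |\<in>| options X 0 \<Longrightarrow> p < N \<Longrightarrow>
        left_wins_from N p (disj_sum G' X') \<Longrightarrow> left_wins_from N p (disj_sum G X')"
      and "left_wins_from N 0 (disj_sum G' X)"
    then consider
        H where "H |\<in>| options ?K 0" "left_wins_from N (Suc 0 mod N) (disj_sum H X)"
      | H where "H |\<in>| options G 0" "left_wins_from N (Suc 0 mod N) (disj_sum H X)"
      | X' where "X' |\<in>| options X 0" "left_wins_from N (Suc 0 mod N) (disj_sum G' X')"
      by (auto simp: left_wins_from_disj_sum_0[of N G'] G'0)
    then show "left_wins_from N 0 (disj_sum G X)"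
    proof cases
      case 1
      then have "left_wins_from N 0 (disj_sum ?K X)"
        unfolding left_wins_from_disj_sum_0[of N ?K] by blast
      then show ?thesis by (rule KG[OF X N(1)])
    qed (use IH N(2) left_wins_from_disj_sum_0[of N G X] in blast)+
  qed (simp add: other)
  moreover have "le_left N G G'"
  proof (rule le_leftI[OF N(1)])
    fix X
    assume X: "is_game N X"
      and IH: "\<And>X' p. X' |\<in>| options X 0 \<Longrightarrow> p < N \<Longrightarrow>
        left_wins_from N p (disj_sum G X') \<Longrightarrow> left_wins_from N p (disj_sum G' X')"
      and "left_wins_from N 0 (disj_sum G X)"
    \<comment> \<open>A Left option of \<open>G\<close> is either \<open>GL\<close> or was kept in
      \<open>G'\<close>.\<close>
    then consider
        "left_wins_from N (Suc 0 mod N) (disj_sum GL X)"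
      | H where "H |\<in>| options G' 0" "left_wins_from N (Suc 0 mod N) (disj_sum H X)"
      | X' where "X' |\<in>| options X 0" "left_wins_from N (Suc 0 mod N) (disj_sum G X')"
      by (auto simp: left_wins_from_disj_sum_0[of N G] G'0)
    then show "left_wins_from N 0 (disj_sum G' X)"
    proof cases
      case 1
      \<comment> \<open>After all \<open>N - 1\<close> replies it is Left's turn again, as
        \<open>Suc (N - 1) mod N = 0\<close>.\<close>
      with left_wins_from_after_replies[OF assms(5), of X "N - 1"] assms(4) N(1)
      have "left_wins_from N 0 (disj_sum ?K X)" by simp
      then consider
          H where "H |\<in>| options ?K 0" "left_wins_from N (Suc 0 mod N) (disj_sum H X)"
        | X' where "X' |\<in>| options X 0" "left_wins_from N (Suc 0 mod N) (disj_sum ?K X')"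
        unfolding left_wins_from_disj_sum_0[of N ?K] by blast
      then show ?thesis
      proof cases
        case 1
        then show ?thesis unfolding left_wins_from_disj_sum_0[of N G'] G'0 by blast
      next
        case 2
        \<comment> \<open>The win passes from \<open>?K\<close> to \<open>G\<close> next to
          \<open>X'\<close> by \<open>KG\<close>, which asks for a proper game \<open>X'\<close>,
          and then from \<open>G\<close> to \<open>G'\<close> by \<open>IH\<close>.\<close>
        have "is_game N X'"
          using X 2(1) N(1) by (auto elim: is_game.cases)
        then have "left_wins_from N (Suc 0 mod N) (disj_sum G' X')"
          using KG IH 2 N(2) by blast
        with 2(1) left_wins_from_disj_sum_0[of N G' X] show ?thesis by blast
      qed
    qed (use IH N(2) left_wins_from_disj_sum_0[of N G' X] in blast)+
  qed (simp add: other)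
  ultimately show ?thesis
    by (simp add: eq_left_def G'_def)
qed

end
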